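(* Let $\Sigma\subset\mathbb{B}^3$ be a smooth, properly immersed free boundary minimal surface with non-degenerate Gauss map $\nu:\Sigma\to\mathbb{S}^2$. Let $g_1$ be the pullback by $\nu$ of the round metric of $\mathbb{S}^2$ to $\Sigma$, and let $\Omega=(\Sigma,g_1)$. Then there is a one-to-one correspondence between the Jacobi-Steklov eigenvalues of $\Sigma$ and the eigenvalues of the following problem on $\Omega$: $$\begin{cases}(\Delta_1+2)u=0 & \text{on }\Omega,\\ (D_1)_{\eta_1}u=|\kappa|\,\lambda\,u & \text{on }\partial\Omega.\end{cases}$$ That is, a real number $\lambda$ is a Jacobi-Steklov eigenvalue of $\Sigma$ if and only if it is an eigenvalue of this problem on $\Omega$. Here $\Delta_1$ is the Laplacian of $g_1$, $\eta_1$ is the outward unit conormal (with respect to $g_1$) along $\partial\Omega$, $(D_1)_{\eta_1}u$ is the derivative of $u$ in the direction $\eta_1$, and $\kappa$ is the geodesic curvature of $\partial\Omega\subset\Omega$ with respect to $g_1$.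
   Context: $\mathbb{B}^3$ is the closed unit ball of $\mathbb{R}^3$ centered at the origin, $\mathbb{S}^2=\partial\mathbb{B}^3$. A (smooth, properly immersed) free boundary minimal surface (FBMS) $\Sigma=X(\Sigma_0)$ in $\mathbb{B}^3$ is the image of a smooth surface with boundary $\Sigma_0$ under a proper smooth isometric immersion $X:\Sigma_0\to\mathbb{B}^3$ (so $\Sigma_0$ is compact) such that $\partial\Sigma=\Sigma\cap\partial\mathbb{B}^3$, the mean curvature vanishes, and $\Sigma$ meets $\partial\mathbb{B}^3$ orthogonally along $\partial\Sigma$. The immersed surface is identified with $\Sigma_0$. $\nu:\Sigma\to\mathbb{S}^2$ is a choice of smooth unit normal field (Gauss map); it is non-degenerate if it is an immersion at every point of $\Sigma$ (including the boundary). $\mathbf{h}$ is the second fundamental form, $\eta$ is the outward unit conormal of $\Sigma$ along $\partial\Sigma$, and $J=\Delta+|\mathbf{h}|^2$ is the Jacobi operator of $\Sigma$. A real number $\lambda$ is a Jacobi-Steklov eigenvalue of $\Sigma$ if there is a nonzero $u\in C^\infty(\Sigma)$ with $Ju=0$ on $\Sigma$ and $D_\eta u=\lambda u$ on $\partial\Sigma$. Likewise $\lambda$ is an eigenvalue of the boundary value problem on $\Omega$ if that problem has a nonzero smooth solution $u$. *)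

theory Defs
  imports "HOL-Analysis.Analysis"
begin

section \<open>Smooth functions up to the boundary\<close>

definition half_plane :: "(real^2) set" where
  "half_plane = {x. 0 \<le> x $ 2}"

primrec C_order :: "nat \<Rightarrow> 'a::euclidean_space set \<Rightarrow> ('a \<Rightarrow> 'b::real_normed_vector) \<Rightarrow> bool" where
  "C_order 0 W f \<longleftrightarrow> continuous_on W f"
| "C_order (Suc k) W f \<longleftrightarrow>
     (\<forall>x\<in>W. f differentiable (at x)) \<and> (\<forall>v. C_order k W (\<lambda>x. frechet_derivative f (at x) v))"

text \<open>On a set that is not open (here: a relatively open subset of the half-plane), smooth means
  locally extensible to a smooth function on an open set.\<close>

definition smooth_on :: "'a::euclidean_space set \<Rightarrow> ('a \<Rightarrow> 'b::real_normed_vector) \<Rightarrow> bool" where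
  "smooth_on S f \<longleftrightarrow>
     (\<forall>x\<in>S. \<exists>W g. open W \<and> x \<in> W \<and> (\<forall>k. C_order k W g) \<and> (\<forall>y\<in>S \<inter> W. f y = g y))"

section \<open>Smooth surfaces with boundary\<close>

text \<open>A chart is recorded by its inverse, the local parametrization: a pair of a relatively open
  set \<open>D\<close> of the half-plane and a homeomorphism \<open>\<psi>\<close> of \<open>D\<close> onto an open set of the surface.
  Interior points may be parametrized by points of \<open>D\<close> off the line \<open>x $ 2 = 0\<close>.\<close>

type_synonym 'a chart = "(real^2) set \<times> (real^2 \<Rightarrow> 'a)"

definition local_parametrization :: "'a topology \<Rightarrow> 'a chart \<Rightarrow> bool" where
  "local_parametrization M = (\<lambda>(D, \<psi>).
     openin (top_of_set half_plane) D \<and> openin M (\<psi> ` D) \<and>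
     homeomorphic_map (top_of_set D) (subtopology M (\<psi> ` D)) \<psi>)"

definition smooth_surface :: "'a topology \<Rightarrow> 'a chart set \<Rightarrow> bool" where
  "smooth_surface M A \<longleftrightarrow>
     Hausdorff_space M \<and> second_countable M \<and>
     (\<forall>c\<in>A. local_parametrization M c) \<and>
     (\<Union>(D, \<psi>)\<in>A. \<psi> ` D) = topspace M \<and>
     (\<forall>(D, \<psi>)\<in>A. \<forall>(D', \<psi>')\<in>A.
        smooth_on {x \<in> D. \<psi> x \<in> \<psi>' ` D'} (inv_into D' \<psi>' \<circ> \<psi>))"

definition surface_boundary :: "'a chart set \<Rightarrow> 'a set" where
  "surface_boundary A = (\<Union>(D, \<psi>)\<in>A. \<psi> ` {x \<in> D. x $ 2 = 0})"

definition smooth_function :: "'a chart set \<Rightarrow> ('a \<Rightarrow> 'b::real_normed_vector) \<Rightarrow> bool" where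
  "smooth_function A f \<longleftrightarrow> (\<forall>(D, \<psi>)\<in>A. smooth_on D (f \<circ> \<psi>))"

text \<open>The derivative of a local representative. It is taken within the half-plane, so it is the
  ordinary derivative off the line \<open>x $ 2 = 0\<close> and one-sided in the second variable on it.\<close>

abbreviation dh :: "(real^2 \<Rightarrow> 'b::real_normed_vector) \<Rightarrow> real^2 \<Rightarrow> real^2 \<Rightarrow> 'b" where
  "dh f x \<equiv> frechet_derivative f (at x within half_plane)"

definition immersion :: "'a chart set \<Rightarrow> ('a \<Rightarrow> 'b::real_normed_vector) \<Rightarrow> bool" where
  "immersion A F \<longleftrightarrow> smooth_function A F \<and> (\<forall>(D, \<psi>)\<in>A. \<forall>x\<in>D. inj (dh (F \<circ> \<psi>) x))"

section \<open>Riemannian geometry in local coordinates\<close>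

text \<open>A metric is given in a chart by its component matrix \<open>g x $ i $ j\<close>.\<close>

type_synonym local_metric = "real^2 \<Rightarrow> real^2^2"

definition pd :: "2 \<Rightarrow> (real^2 \<Rightarrow> 'b::real_normed_vector) \<Rightarrow> real^2 \<Rightarrow> 'b" where
  "pd i f x = dh f x (axis i 1)"

text \<open>The metric \<open>F\<^sup>*\<langle>\<cdot>,\<cdot>\<rangle>\<close> for a local representative \<open>F\<close>. If \<open>F\<close> takes values in the unit sphere,
  this is the pullback of the round metric, which is the restriction of the Euclidean one.\<close>

definition pullback_metric :: "(real^2 \<Rightarrow> real^3) \<Rightarrow> local_metric" where
  "pullback_metric F x = (\<chi> i j. pd i F x \<bullet> pd j F x)"

definition metric_inner :: "local_metric \<Rightarrow> real^2 \<Rightarrow> real^2 \<Rightarrow> real^2 \<Rightarrow> real" where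
  "metric_inner g x v w = (\<Sum>i\<in>UNIV. \<Sum>j\<in>UNIV. g x $ i $ j * v $ i * w $ j)"

definition laplacian :: "local_metric \<Rightarrow> (real^2 \<Rightarrow> real) \<Rightarrow> real^2 \<Rightarrow> real" where
  "laplacian g u x =
     (\<Sum>i\<in>UNIV. pd i (\<lambda>y. sqrt (det (g y)) *
        (\<Sum>j\<in>UNIV. matrix_inv (g y) $ i $ j * pd j u y)) x) / sqrt (det (g x))"

definition christoffel :: "local_metric \<Rightarrow> 2 \<Rightarrow> 2 \<Rightarrow> 2 \<Rightarrow> real^2 \<Rightarrow> real" where
  "christoffel g k i j x = (\<Sum>l\<in>UNIV. matrix_inv (g x) $ k $ l *
     (pd i (\<lambda>y. g y $ j $ l) x + pd j (\<lambda>y. g y $ i $ l) x - pd l (\<lambda>y. g y $ i $ j) x)) / 2"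

text \<open>The outward unit conormal at a point \<open>x\<close> with \<open>x $ 2 = 0\<close>; the boundary is tangent to
  \<open>axis 1 1\<close> there.\<close>

definition outward_conormal :: "local_metric \<Rightarrow> real^2 \<Rightarrow> real^2" where
  "outward_conormal g x = (THE v.
     metric_inner g x v v = 1 \<and> metric_inner g x v (axis 1 1) = 0 \<and> v $ 2 < 0)"

definition covariant_acceleration :: "local_metric \<Rightarrow> (real \<Rightarrow> real^2) \<Rightarrow> real \<Rightarrow> real^2" where
  "covariant_acceleration g \<gamma> t =
     (let \<gamma>' = (\<lambda>s. vector_derivative \<gamma> (at s))
      in \<chi> k. vector_derivative \<gamma>' (at t) $ k +
           (\<Sum>i\<in>UNIV. \<Sum>j\<in>UNIV. christoffel g k i j (\<gamma> t) * \<gamma>' t $ i * \<gamma>' t $ j))"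

text \<open>Geodesic curvature, with respect to the inward conormal, of the boundary curve
  \<open>t \<mapsto> (t, 0)\<close>, which need not have unit speed.\<close>

definition boundary_geodesic_curvature :: "local_metric \<Rightarrow> real^2 \<Rightarrow> real" where
  "boundary_geodesic_curvature g x =
     (let \<gamma> = (\<lambda>t. vector [t, 0]); \<gamma>' = vector_derivative \<gamma> (at (x $ 1))
      in metric_inner g x (covariant_acceleration g \<gamma> (x $ 1)) (- outward_conormal g x)
           / metric_inner g x \<gamma>' \<gamma>')"

section \<open>Extrinsic geometry\<close>

definition unit_normal :: "(real^2 \<Rightarrow> real^3) \<Rightarrow> real^2 \<Rightarrow> real^3 \<Rightarrow> bool" where
  "unit_normal Y x n \<longleftrightarrow> norm n = 1 \<and> (\<forall>v. dh Y x v \<bullet> n = 0)"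

definition second_form :: "(real^2 \<Rightarrow> real^3) \<Rightarrow> real^2 \<Rightarrow> real^3 \<Rightarrow> real^2^2" where
  "second_form Y x n = (\<chi> i j. pd i (pd j Y) x \<bullet> n)"

definition mean_curvature :: "(real^2 \<Rightarrow> real^3) \<Rightarrow> real^2 \<Rightarrow> real^3 \<Rightarrow> real" where
  "mean_curvature Y x n =
     (\<Sum>i\<in>UNIV. \<Sum>j\<in>UNIV. matrix_inv (pullback_metric Y x) $ i $ j * second_form Y x n $ i $ j)"

text \<open>\<open>|h|\<^sup>2 = g\<^sup>i\<^sup>k g\<^sup>j\<^sup>l h\<^sub>i\<^sub>j h\<^sub>k\<^sub>l\<close>\<close>

definition second_form_norm_sq :: "(real^2 \<Rightarrow> real^3) \<Rightarrow> real^2 \<Rightarrow> real^3 \<Rightarrow> real" where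
  "second_form_norm_sq Y x n =
     (let G = matrix_inv (pullback_metric Y x); h = second_form Y x n
      in \<Sum>i\<in>UNIV. \<Sum>j\<in>UNIV. \<Sum>k\<in>UNIV. \<Sum>l\<in>UNIV.
           G $ i $ k * G $ j $ l * h $ i $ j * h $ k $ l)"

text \<open>Minimality and orthogonality do not depend on the choice of one of the two unit normals
  \<open>n\<close> at a point, so no orientation is needed. The unit normal of the unit sphere at \<open>X p\<close> is
  \<open>X p\<close> itself.\<close>

definition free_boundary_minimal_surface ::
  "'a topology \<Rightarrow> 'a chart set \<Rightarrow> ('a \<Rightarrow> real^3) \<Rightarrow> bool" where
  "free_boundary_minimal_surface M A X \<longleftrightarrow>
     smooth_surface M A \<and>
     immersion A X \<and>
     X ` topspace M \<subseteq> cball 0 1 \<and>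
     proper_map M (top_of_set (cball 0 1)) X \<and>
     X ` surface_boundary A = X ` topspace M \<inter> sphere 0 1 \<and>
     (\<forall>(D, \<psi>)\<in>A. \<forall>x\<in>D. \<forall>n. unit_normal (X \<circ> \<psi>) x n \<longrightarrow> mean_curvature (X \<circ> \<psi>) x n = 0) \<and>
     (\<forall>(D, \<psi>)\<in>A. \<forall>x\<in>D. x $ 2 = 0 \<longrightarrow>
        (\<forall>n. unit_normal (X \<circ> \<psi>) x n \<longrightarrow> n \<bullet> X (\<psi> x) = 0))"

definition gauss_map :: "'a chart set \<Rightarrow> ('a \<Rightarrow> real^3) \<Rightarrow> ('a \<Rightarrow> real^3) \<Rightarrow> bool" where
  "gauss_map A X \<nu> \<longleftrightarrow>
     smooth_function A \<nu> \<and> (\<forall>(D, \<psi>)\<in>A. \<forall>x\<in>D. unit_normal (X \<circ> \<psi>) x (\<nu> (\<psi> x)))"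

section \<open>The two eigenvalue problems\<close>

text \<open>The equations are imposed in every chart; they are invariant under change of chart.\<close>

definition jacobi_steklov_eigenvalue ::
  "'a topology \<Rightarrow> 'a chart set \<Rightarrow> ('a \<Rightarrow> real^3) \<Rightarrow> ('a \<Rightarrow> real^3) \<Rightarrow> real \<Rightarrow> bool" where
  "jacobi_steklov_eigenvalue M A X \<nu> \<mu> \<longleftrightarrow>
     (\<exists>u :: 'a \<Rightarrow> real. smooth_function A u \<and> (\<exists>p\<in>topspace M. u p \<noteq> 0) \<and>
        (\<forall>(D, \<psi>)\<in>A. let g = pullback_metric (X \<circ> \<psi>) in
           (\<forall>x\<in>D. laplacian g (u \<circ> \<psi>) x
                    + second_form_norm_sq (X \<circ> \<psi>) x (\<nu> (\<psi> x)) * u (\<psi> x) = 0) \<and>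
           (\<forall>x\<in>D. x $ 2 = 0 \<longrightarrow> dh (u \<circ> \<psi>) x (outward_conormal g x) = \<mu> * u (\<psi> x))))"

definition gauss_image_eigenvalue ::
  "'a topology \<Rightarrow> 'a chart set \<Rightarrow> ('a \<Rightarrow> real^3) \<Rightarrow> real \<Rightarrow> bool" where
  "gauss_image_eigenvalue M A \<nu> \<mu> \<longleftrightarrow>
     (\<exists>u :: 'a \<Rightarrow> real. smooth_function A u \<and> (\<exists>p\<in>topspace M. u p \<noteq> 0) \<and>
        (\<forall>(D, \<psi>)\<in>A. let g1 = pullback_metric (\<nu> \<circ> \<psi>) in
           (\<forall>x\<in>D. laplacian g1 (u \<circ> \<psi>) x + 2 * u (\<psi> x) = 0) \<and>
           (\<forall>x\<in>D. x $ 2 = 0 \<longrightarrow>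
              dh (u \<circ> \<psi>) x (outward_conormal g1 x)
                = \<bar>boundary_geodesic_curvature g1 x\<bar> * \<mu> * u (\<psi> x))))"

end

theory Submission
  imports Defs
begin

text \<open>Let \<open>g\<close> be the metric of the surface. The shape operator of a minimal surface is symmetric and
  trace-free, so its square is half the squared norm \<open>\<phi> = |h|\<^sup>2 / 2\<close> of \<open>h\<close> times the identity; hence
  \<open>g\<^sub>1 = \<phi> g\<close>, and \<open>\<phi> > 0\<close> by non-degeneracy. In dimension two the Laplacian scales by \<open>1 / \<phi>\<close> under
  this change, so that \<open>\<Delta> + |h|\<^sup>2 = \<phi> (\<Delta>\<^sub>1 + 2)\<close>, while the unit conormal scales by \<open>1 / sqrt \<phi>\<close>. It
  remains to see that \<open>|\<kappa>| = 1 / sqrt \<phi>\<close>. Along the boundary \<open>X\<close> is orthogonal to \<open>\<nu>\<close> and to the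
  derivatives \<open>X'\<close> and \<open>\<nu>'\<close> along the boundary, so \<open>X\<close> is, up to sign, the conormal of the Gauss
  image, and \<open>X'\<close> and \<open>\<nu>'\<close> are parallel. Therefore
  \<open>|\<kappa>| = |\<nu>'' \<bullet> X| / |\<nu>'|\<^sup>2 = |\<nu>' \<bullet> X'| / |\<nu>'|\<^sup>2 = |X'| / |\<nu>'|\<close>.\<close>

section \<open>Symmetry of second derivatives\<close>

text \<open>The mean value theorem is applied twice: along \<open>v\<close> to the difference of
  \<open>f\<close> over two opposite edges of the parallelogram, then along \<open>w\<close> to the
  derivative in direction \<open>v\<close>. The left side is unchanged when \<open>v\<close> and
  \<open>w\<close> are swapped.\<close>

lemma second_difference_mean_value:
  fixes f :: "'a::real_normed_vector \<Rightarrow> real"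
  assumes f: "\<And>y. y \<in> W \<Longrightarrow> (f has_derivative f' y) (at y)"
    and f'': "\<And>y. y \<in> W \<Longrightarrow> ((\<lambda>z. f' z v) has_derivative f'' y) (at y)"
    and "s > 0"
    and W: "\<And>a b. \<lbrakk>0 \<le> a; a \<le> s; 0 \<le> b; b \<le> s\<rbrakk> \<Longrightarrow> x + a *\<^sub>R v + b *\<^sub>R w \<in> W"
  shows "\<exists>a b. 0 \<le> a \<and> a \<le> s \<and> 0 \<le> b \<and> b \<le> s \<and>
    f (x + s *\<^sub>R v + s *\<^sub>R w) - f (x + s *\<^sub>R v) - f (x + s *\<^sub>R w) + f x
      = s\<^sup>2 * f'' (x + a *\<^sub>R v + b *\<^sub>R w) w"
proof -
  have d1: "((\<lambda>t. f (x + t *\<^sub>R v + c *\<^sub>R w)) has_real_derivative f' (x + t *\<^sub>R v + c *\<^sub>R w) v) (at t)"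
    if "0 \<le> t" "t \<le> s" "0 \<le> c" "c \<le> s" for t c
  proof -
    have "((\<lambda>t. x + t *\<^sub>R v + c *\<^sub>R w) has_derivative (\<lambda>h. h *\<^sub>R v)) (at t)"
      by (auto intro!: derivative_eq_intros)
    from has_derivative_compose[OF this f[OF W[OF that]]]
    show ?thesis
      using linear_cmul[OF has_derivative_linear[OF f[OF W[OF that]]]]
      by (simp add: has_field_derivative_def mult_commute_abs)
  qed
  have d2: "((\<lambda>t. f' (x + c *\<^sub>R v + t *\<^sub>R w) v) has_real_derivative f'' (x + c *\<^sub>R v + t *\<^sub>R w) w) (at t)"
    if "0 \<le> c" "c \<le> s" "0 \<le> t" "t \<le> s" for t c
  proof -
    have "((\<lambda>t. x + c *\<^sub>R v + t *\<^sub>R w) has_derivative (\<lambda>h. h *\<^sub>R w)) (at t)"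
      by (auto intro!: derivative_eq_intros)
    from has_derivative_compose[OF this f''[OF W[OF that]]]
    show ?thesis
      using linear_cmul[OF has_derivative_linear[OF f''[OF W[OF that]]]]
      by (simp add: has_field_derivative_def mult_commute_abs)
  qed
  have "\<exists>a. 0 < a \<and> a < s \<and>
     (f (x + s *\<^sub>R v + s *\<^sub>R w) - f (x + s *\<^sub>R v + 0 *\<^sub>R w)) - (f (x + 0 *\<^sub>R v + s *\<^sub>R w) - f (x + 0 *\<^sub>R v + 0 *\<^sub>R w))
       = (s - 0) * (f' (x + a *\<^sub>R v + s *\<^sub>R w) v - f' (x + a *\<^sub>R v + 0 *\<^sub>R w) v)"
    using \<open>s > 0\<close> by (intro MVT2 DERIV_diff d1) auto
  then obtain a where a: "0 < a" "a < s" and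
    ea: "f (x + s *\<^sub>R v + s *\<^sub>R w) - f (x + s *\<^sub>R v) - f (x + s *\<^sub>R w) + f x
       = s * (f' (x + a *\<^sub>R v + s *\<^sub>R w) v - f' (x + a *\<^sub>R v + 0 *\<^sub>R w) v)"
    by auto
  have "\<exists>b. 0 < b \<and> b < s \<and>
     f' (x + a *\<^sub>R v + s *\<^sub>R w) v - f' (x + a *\<^sub>R v + 0 *\<^sub>R w) v
       = (s - 0) * f'' (x + a *\<^sub>R v + b *\<^sub>R w) w"
    using \<open>s > 0\<close> a by (intro MVT2 d2) auto
  then obtain b where "0 < b" "b < s" and
    eb: "f' (x + a *\<^sub>R v + s *\<^sub>R w) v - f' (x + a *\<^sub>R v + 0 *\<^sub>R w) v
      = s * f'' (x + a *\<^sub>R v + b *\<^sub>R w) w"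
    by auto
  with a ea[unfolded eb] show ?thesis
    by (intro exI[of _ a] exI[of _ b]) (simp add: power2_eq_square)
qed

text \<open>The same second difference is \<open>s\<^sup>2\<close> times either mixed derivative,
  each taken at some point of a small parallelogram. If the two differed at \<open>x\<close>,
  continuity would keep them apart on all of it.\<close>

lemma symmetric_second_derivative_real:
  fixes f :: "'a::real_normed_vector \<Rightarrow> real"
  assumes "open W" "x \<in> W"
    and f: "\<And>y. y \<in> W \<Longrightarrow> (f has_derivative f' y) (at y)"
    and fv: "\<And>y. y \<in> W \<Longrightarrow> ((\<lambda>z. f' z v) has_derivative fv y) (at y)"
    and fw: "\<And>y. y \<in> W \<Longrightarrow> ((\<lambda>z. f' z w) has_derivative fw y) (at y)"
    and cont: "continuous (at x) (\<lambda>y. fv y w)" "continuous (at x) (\<lambda>y. fw y v)"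
  shows "fv x w = fw x v"
proof (rule ccontr)
  assume ne: "fv x w \<noteq> fw x v"
  \<comment> \<open>Half the gap: two values that are each within less than \<open>e\<close> of the
    two limits cannot coincide.\<close>
  define e where "e = \<bar>fv x w - fw x v\<bar> / 2"
  have "e > 0" using ne by (simp add: e_def)
  obtain d1 where d1: "d1 > 0" "ball x d1 \<subseteq> W"
    using assms(1,2) open_contains_ball by blast
  obtain d2 where d2: "d2 > 0" "\<And>y. dist y x < d2 \<Longrightarrow> \<bar>fv y w - fv x w\<bar> < e"
    using cont(1) \<open>e > 0\<close> unfolding continuous_at_eps_delta dist_real_def by metis
  obtain d3 where d3: "d3 > 0" "\<And>y. dist y x < d3 \<Longrightarrow> \<bar>fw y v - fw x v\<bar> < e"
    using cont(2) \<open>e > 0\<close> unfolding continuous_at_eps_delta dist_real_def by metis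
  define d where "d = min d1 (min d2 d3)"
  \<comment> \<open>This keeps the whole parallelogram within \<open>d\<close> of \<open>x\<close>;
    the summand 1 guards against \<open>v = w = 0\<close>.\<close>
  define s where "s = d / 2 / (norm v + norm w + 1)"
  have "d > 0" using d1 d2 d3 by (simp add: d_def)
  have "norm v + norm w + 1 > 0" by (smt (verit) norm_ge_zero)
  then have "s > 0" using \<open>d > 0\<close> by (simp add: s_def)
  have small: "dist (x + a *\<^sub>R v + b *\<^sub>R w) x < d" if "0 \<le> a" "a \<le> s" "0 \<le> b" "b \<le> s" for a b
  proof -
    have "dist (x + a *\<^sub>R v + b *\<^sub>R w) x = norm (a *\<^sub>R v + b *\<^sub>R w)"
      by (simp add: dist_norm add.assoc)
    also have "\<dots> \<le> a * norm v + b * norm w"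
      using that norm_triangle_ineq[of "a *\<^sub>R v" "b *\<^sub>R w"] by simp
    also have "\<dots> \<le> s * norm v + s * norm w"
      using that by (intro add_mono mult_right_mono) auto
    also have "\<dots> \<le> s * (norm v + norm w + 1)"
      using \<open>s > 0\<close> by (simp add: algebra_simps)
    also have "\<dots> = d / 2"
      using \<open>norm v + norm w + 1 > 0\<close> s_def nonzero_eq_divide_eq by (metis less_irrefl)
    finally show ?thesis using \<open>d > 0\<close> by linarith
  qed
  have inW: "x + a *\<^sub>R v + b *\<^sub>R w \<in> W" if "0 \<le> a" "a \<le> s" "0 \<le> b" "b \<le> s" for a b
    using small[OF that] d1 by (auto simp: d_def dist_commute subset_iff)
  have inW': "x + a *\<^sub>R w + b *\<^sub>R v \<in> W" if "0 \<le> a" "a \<le> s" "0 \<le> b" "b \<le> s" for a b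
    using inW[of b a] that by (simp add: add_ac)
  obtain a b where ab: "0 \<le> a" "a \<le> s" "0 \<le> b" "b \<le> s" and
    e1: "f (x + s *\<^sub>R v + s *\<^sub>R w) - f (x + s *\<^sub>R v) - f (x + s *\<^sub>R w) + f x
      = s\<^sup>2 * fv (x + a *\<^sub>R v + b *\<^sub>R w) w"
    using second_difference_mean_value[OF f fv \<open>s > 0\<close> inW] by blast
  obtain a' b' where ab': "0 \<le> a'" "a' \<le> s" "0 \<le> b'" "b' \<le> s" and
    e2: "f (x + s *\<^sub>R w + s *\<^sub>R v) - f (x + s *\<^sub>R w) - f (x + s *\<^sub>R v) + f x
      = s\<^sup>2 * fw (x + a' *\<^sub>R w + b' *\<^sub>R v) v"
    using second_difference_mean_value[OF f fw \<open>s > 0\<close> inW'] by blast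
  have "s\<^sup>2 * fv (x + a *\<^sub>R v + b *\<^sub>R w) w = s\<^sup>2 * fw (x + b' *\<^sub>R v + a' *\<^sub>R w) v"
    using e1 e2[unfolded add.assoc add.commute[of "s *\<^sub>R w"] add.commute[of "a' *\<^sub>R w"]]
    unfolding add.assoc by linarith
  then have eq: "fv (x + a *\<^sub>R v + b *\<^sub>R w) w = fw (x + b' *\<^sub>R v + a' *\<^sub>R w) v"
    using \<open>s > 0\<close> by simp
  have "\<bar>fv (x + a *\<^sub>R v + b *\<^sub>R w) w - fv x w\<bar> < e"
    using small[OF ab] by (intro d2) (simp add: d_def)
  moreover have "\<bar>fw (x + b' *\<^sub>R v + a' *\<^sub>R w) v - fw x v\<bar> < e"
    using small[of b' a'] ab' by (intro d3) (simp add: d_def)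
  ultimately show False using eq unfolding e_def by (smt (verit) field_sum_of_halves)
qed

text \<open>Reduction to real values by taking the inner product with an arbitrary fixed vector
  \<open>c\<close>.\<close>

lemma symmetric_second_derivative:
  fixes f :: "'a::real_normed_vector \<Rightarrow> 'b::real_inner"
  assumes "open W" "x \<in> W"
    and f: "\<And>y. y \<in> W \<Longrightarrow> (f has_derivative f' y) (at y)"
    and fv: "\<And>y. y \<in> W \<Longrightarrow> ((\<lambda>z. f' z v) has_derivative fv y) (at y)"
    and fw: "\<And>y. y \<in> W \<Longrightarrow> ((\<lambda>z. f' z w) has_derivative fw y) (at y)"
    and cont: "continuous (at x) (\<lambda>y. fv y w)" "continuous (at x) (\<lambda>y. fw y v)"
  shows "fv x w = fw x v"
proof -
  have "fv x w \<bullet> c = fw x v \<bullet> c" for c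
    by (rule symmetric_second_derivative_real[where f = "\<lambda>y. f y \<bullet> c" and f' = "\<lambda>y h. f' y h \<bullet> c"
          and fv = "\<lambda>y h. fv y h \<bullet> c" and fw = "\<lambda>y h. fw y h \<bullet> c", OF assms(1,2)])
      (intro has_derivative_inner_left continuous_intros f fv fw cont, assumption?)+
  then show ?thesis by (metis inner_commute vector_eq_rdot)
qed

section \<open>Calculus on relatively open subsets of the half-plane\<close>

lemma C_order_subset: "C_order k W f \<Longrightarrow> W' \<subseteq> W \<Longrightarrow> C_order k W' f"
  by (induction k arbitrary: f) (auto intro: continuous_on_subset)

text \<open>From every point of the half-plane, boundary points included, small positive steps along
  both axes stay inside; this determines the derivative, so \<open>dh\<close> is meaningful on the
  boundary line.\<close>

lemma has_derivative_half_plane_unique: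
  assumes "(f has_derivative f') (at x within half_plane)" "(f has_derivative f'') (at x within half_plane)"
    and "x \<in> half_plane"
  shows "f' = f''"
proof (rule frechet_derivative_unique_within[OF assms(1,2)])
  fix i :: "real^2" and e :: real
  assume "i \<in> Basis" "0 < e"
  then show "\<exists>d. 0 < \<bar>d\<bar> \<and> \<bar>d\<bar> < e \<and> x + d *\<^sub>R i \<in> half_plane"
    using assms(3) by (intro exI[of _ "e/2"]) (auto simp: half_plane_def Basis_vec_def axis_def)
qed

lemma dh_eqI:
  assumes "(f has_derivative f') (at x within half_plane)" "x \<in> half_plane"
  shows "dh f x = f'"
  using has_derivative_half_plane_unique[OF _ assms] assms(1)
  by (metis differentiableI frechet_derivative_works)

lemma dh_const: "x \<in> half_plane \<Longrightarrow> dh (\<lambda>_. c) x v = 0"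
  by (subst dh_eqI[OF has_derivative_const]) auto

lemma has_derivative_half_plane_transform:
  assumes "openin (top_of_set half_plane) D" "x \<in> D" "\<And>y. y \<in> D \<Longrightarrow> f y = g y"
    and "(f has_derivative f') (at x within half_plane)"
  shows "(g has_derivative f') (at x within half_plane)"
proof -
  obtain T where T: "open T" "D = half_plane \<inter> T" using assms(1) openin_open by blast
  have "\<forall>\<^sub>F y in at x within half_plane. f y = g y"
    unfolding eventually_at_topological using T assms by (intro exI[of _ T]) auto
  then show ?thesis using assms T
    by (metis IntE has_derivative_transform_eventually)
qed

lemma dh_cong:
  assumes "openin (top_of_set half_plane) D" "x \<in> D" "\<And>y. y \<in> D \<Longrightarrow> f y = g y"
  shows "dh f x = dh g x"
proof -
  have "(f has_derivative f') (at x within half_plane) \<longleftrightarrow> (g has_derivative f') (at x within half_plane)" for f'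
    using has_derivative_half_plane_transform[OF assms(1,2)] assms(3) by metis
  then show ?thesis by (simp add: frechet_derivative_def)
qed

text \<open>Shrinking \<open>W\<close> by an open set that cuts \<open>D\<close> out of the
  half-plane turns agreement on \<open>D\<close> near \<open>x\<close> into agreement on
  \<open>half_plane \<inter> W\<close>.\<close>

lemma smooth_on_extension:
  assumes "smooth_on D f" "openin (top_of_set half_plane) D" "x \<in> D"
  obtains W g where "open W" "x \<in> W" "\<And>k. C_order k W g" "\<And>y. y \<in> half_plane \<inter> W \<Longrightarrow> f y = g y"
    "half_plane \<inter> W \<subseteq> D"
proof -
  obtain W g where W: "open W" "x \<in> W" "\<And>k. C_order k W g" "\<And>y. y \<in> D \<inter> W \<Longrightarrow> f y = g y"
    using assms unfolding smooth_on_def by meson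
  obtain T where T: "open T" "D = half_plane \<inter> T" using assms(2) openin_open by blast
  show thesis
    by (rule that[of "W \<inter> T" g]) (use W T assms(3) in \<open>auto intro: C_order_subset\<close>)
qed

lemma C_order_has_derivative:
  assumes "\<And>k. C_order k W g" "y \<in> W"
  shows "(g has_derivative frechet_derivative g (at y)) (at y)"
  using assms(1)[of 1] assms(2) frechet_derivative_works by (fastforce simp: One_nat_def)

lemma C_order_directional:
  assumes "\<And>k. C_order k W g"
  shows "C_order k W (\<lambda>y. frechet_derivative g (at y) v)"
  using assms[of "Suc k"] by simp

text \<open>One-sided derivatives become ordinary derivatives of an extension, so calculus on open
  sets applies at boundary points.\<close>

lemma dh_eq_extension:
  assumes "openin (top_of_set half_plane) D" "half_plane \<inter> W \<subseteq> D" "open W"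
   "\<And>k. C_order k W g" "\<And>y. y \<in> half_plane \<inter> W \<Longrightarrow> f y = g y" "y \<in> half_plane \<inter> W"
  shows "(f has_derivative frechet_derivative g (at y)) (at y within half_plane)"
    "dh f y = frechet_derivative g (at y)"
proof -
  have o: "openin (top_of_set half_plane) (half_plane \<inter> W)"
    using assms(3) by (simp add: openin_open_Int)
  have "(g has_derivative frechet_derivative g (at y)) (at y within half_plane)"
    using C_order_has_derivative[OF assms(4)] assms(6) has_derivative_at_withinI by blast
  then show *: "(f has_derivative frechet_derivative g (at y)) (at y within half_plane)"
    using has_derivative_half_plane_transform[OF o assms(6)] assms(5) by metis
  then show "dh f y = frechet_derivative g (at y)"
    using dh_eqI assms(6) by blast
qed

context
  fixes D :: "(real^2) set" and f :: "real^2 \<Rightarrow> 'b::real_normed_vector"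
  assumes D: "openin (top_of_set half_plane) D" and f: "smooth_on D f"
begin

lemma smooth_on_has_derivative:
  assumes "x \<in> D"
  shows "(f has_derivative dh f x) (at x within half_plane)"
proof -
  obtain W g where W: "open W" "x \<in> W" "\<And>k. C_order k W g" "\<And>y. y \<in> half_plane \<inter> W \<Longrightarrow> f y = g y"
    "half_plane \<inter> W \<subseteq> D" using smooth_on_extension[OF f D assms] by blast
  have "x \<in> half_plane \<inter> W" using D assms W openin_imp_subset by blast
  from dh_eq_extension[OF D W(5,1,3,4) this] show ?thesis by simp
qed

lemma smooth_on_pd: "smooth_on D (pd i f)"
  unfolding smooth_on_def
proof
  fix x assume "x \<in> D"
  then obtain W g where W: "open W" "x \<in> W" "\<And>k. C_order k W g" "\<And>y. y \<in> half_plane \<inter> W \<Longrightarrow> f y = g y"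
    "half_plane \<inter> W \<subseteq> D" using smooth_on_extension[OF f D] by blast
  have "D \<subseteq> half_plane" using D openin_imp_subset by blast
  then show "\<exists>W g. open W \<and> x \<in> W \<and> (\<forall>k. C_order k W g) \<and> (\<forall>y\<in>D \<inter> W. pd i f y = g y)"
    using W(1,2) C_order_directional[OF W(3)] dh_eq_extension(2)[OF D W(5,1,3,4)]
    by (intro exI[of _ W] exI[of _ "\<lambda>y. frechet_derivative g (at y) (axis i 1)"]) (auto simp: pd_def)
qed

end

text \<open>Even at a boundary point both sides are second derivatives of one extension
  \<open>g\<close> on an open neighbourhood, where symmetry is available.\<close>

lemma pd_commute:
  fixes f :: "real^2 \<Rightarrow> 'b::real_inner"
  assumes D: "openin (top_of_set half_plane) D" and f: "smooth_on D f" and "x \<in> D"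
  shows "pd i (pd j f) x = pd j (pd i f) x"
proof -
  obtain W g where W: "open W" "x \<in> W" "\<And>k. C_order k W g" "\<And>y. y \<in> half_plane \<inter> W \<Longrightarrow> f y = g y"
    "half_plane \<inter> W \<subseteq> D" using smooth_on_extension[OF f D \<open>x \<in> D\<close>] by blast
  have x: "x \<in> half_plane \<inter> W" using D assms W openin_imp_subset by blast
  define g' where "g' y = frechet_derivative g (at y)" for y
  define g'' where "g'' v y = frechet_derivative (\<lambda>z. g' z v) (at y)" for v y
  have C: "C_order k W (\<lambda>z. g' z v)" for k v
    unfolding g'_def by (rule C_order_directional[OF W(3)])
  have pd: "pd i f y = g' y (axis i 1)" if "y \<in> half_plane \<inter> W" for i y
    using dh_eq_extension(2)[OF D W(5,1,3,4) that] by (simp add: pd_def g'_def)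
  have pd2: "pd i (pd j f) x = g'' (axis j 1) x (axis i 1)" for i j
    using dh_eq_extension(2)[OF D W(5,1) C pd x] by (simp add: pd_def[of i] g''_def)
  have "g'' v x w = g'' w x v" for v w
  proof (rule symmetric_second_derivative[OF W(1,2)])
    show "(g has_derivative g' y) (at y)" if "y \<in> W" for y
      using C_order_has_derivative[OF W(3) that] by (simp add: g'_def)
    have "((\<lambda>z. g' z v) has_derivative g'' v y) (at y)" if "y \<in> W" for y v
      using C_order_has_derivative[OF C that] by (simp add: g''_def)
    then show "\<And>y. y \<in> W \<Longrightarrow> ((\<lambda>z. g' z v) has_derivative g'' v y) (at y)"
      "\<And>y. y \<in> W \<Longrightarrow> ((\<lambda>z. g' z w) has_derivative g'' w y) (at y)" by blast+
    have "continuous_on W (\<lambda>y. g'' v y w)" for v w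
      using C_order_directional[OF C, of 0 v w] by (simp add: g''_def)
    then show "continuous (at x) (\<lambda>y. g'' v y w)" "continuous (at x) (\<lambda>y. g'' w y v)"
      using W(1,2) continuous_on_eq_continuous_at by blast+
  qed
  then show ?thesis by (simp add: pd2)
qed

lemma dh_inner:
  assumes "openin (top_of_set half_plane) D" "smooth_on D f" "smooth_on D g" "x \<in> D"
  shows "dh (\<lambda>y. f y \<bullet> g y) x v = f x \<bullet> dh g x v + dh f x v \<bullet> g x"
    "((\<lambda>y. f y \<bullet> g y) has_derivative (\<lambda>v. f x \<bullet> dh g x v + dh f x v \<bullet> g x)) (at x within half_plane)"
proof -
  show *: "((\<lambda>y. f y \<bullet> g y) has_derivative (\<lambda>v. f x \<bullet> dh g x v + dh f x v \<bullet> g x)) (at x within half_plane)"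
    by (rule has_derivative_inner[OF smooth_on_has_derivative[OF assms(1,2,4)]
          smooth_on_has_derivative[OF assms(1,3,4)]])
  show "dh (\<lambda>y. f y \<bullet> g y) x v = f x \<bullet> dh g x v + dh f x v \<bullet> g x"
    using assms(1,4) openin_imp_subset by (subst dh_eqI[OF *]) auto
qed

text \<open>The line through \<open>x\<close> in direction \<open>axis 1 1\<close> stays in the
  boundary on both sides of \<open>x\<close>, and \<open>f\<close> is constant on it near
  \<open>x\<close>. This allows identities that hold only on the boundary to be differentiated
  tangentially.\<close>

lemma boundary_directional_derivative_zero:
  fixes f :: "real^2 \<Rightarrow> real"
  assumes "openin (top_of_set half_plane) D" "x \<in> D" "x $ 2 = 0"
    and "(f has_derivative f') (at x within half_plane)"
    and zero: "\<And>y. y \<in> D \<Longrightarrow> y $ 2 = 0 \<Longrightarrow> f y = c"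
  shows "f' (axis 1 1) = 0"
proof -
  let ?\<gamma> = "\<lambda>t::real. x + t *\<^sub>R axis 1 1"
  have half: "?\<gamma> t \<in> half_plane" for t
    using assms(3) by (simp add: half_plane_def axis_def)
  have "(?\<gamma> has_derivative (\<lambda>h. h *\<^sub>R axis 1 1)) (at 0)"
    by (auto intro!: derivative_eq_intros)
  moreover have "(f has_derivative f') (at (?\<gamma> 0) within range ?\<gamma>)"
    using assms(4) has_derivative_subset half by (metis (no_types, lifting) add.right_neutral image_subsetI scale_zero_left)
  ultimately have 1: "((\<lambda>t. f (?\<gamma> t)) has_derivative (\<lambda>h. f' (h *\<^sub>R axis 1 1))) (at 0)"
    by (rule has_derivative_in_compose)
  obtain T where T: "open T" "D = half_plane \<inter> T" using assms(1) openin_open by blast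
  have "open (?\<gamma> -` T)" using T(1) by (intro continuous_open_vimage continuous_intros)
  moreover have "0 \<in> ?\<gamma> -` T" using T assms(2) by simp
  moreover have "f (?\<gamma> t) = c" if "t \<in> ?\<gamma> -` T" for t
    using that T half[of t] assms(3) by (intro zero) (auto simp: axis_def)
  ultimately have 2: "((\<lambda>t. f (?\<gamma> t)) has_derivative (\<lambda>h. 0)) (at 0)"
    by (intro has_derivative_transform_within_open[OF has_derivative_const[of c]]) auto
  show ?thesis using fun_cong[OF has_derivative_unique[OF 1 2], of 1] by simp
qed

section \<open>Linear algebra of plane metrics and of orthogonal frames\<close>

lemma matrix_inv_2:
  fixes A :: "real^2^2"
  assumes "det A \<noteq> 0"
  shows "matrix_inv A $ 1 $ 1 = A $ 2 $ 2 / det A" "matrix_inv A $ 1 $ 2 = - A $ 1 $ 2 / det A"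
    "matrix_inv A $ 2 $ 1 = - A $ 2 $ 1 / det A" "matrix_inv A $ 2 $ 2 = A $ 1 $ 1 / det A"
proof -
  define d where "d = det A"
  define B :: "real^2^2" where "B = vector [vector [A$2$2 / d, - A$1$2 / d], vector [- A$2$1 / d, A$1$1 / d]]"
  have d: "d \<noteq> 0" "A $ 1 $ 1 * A $ 2 $ 2 = d + A $ 1 $ 2 * A $ 2 $ 1"
    using assms by (simp_all add: d_def det_2)
  have BA: "B ** A = mat 1"
    using d by (simp add: B_def vec_eq_iff forall_2 matrix_matrix_mult_def sum_2 mat_def field_simps)
  moreover have "invertible A" using assms invertible_det_nz by blast
  then have "A ** matrix_inv A = mat 1"
    unfolding invertible_def matrix_inv_def by (rule someI2_ex) blast
  ultimately have "matrix_inv A = B"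
    by (metis matrix_mul_assoc matrix_mul_lid matrix_mul_rid)
  then show "matrix_inv A $ 1 $ 1 = A $ 2 $ 2 / det A" "matrix_inv A $ 1 $ 2 = - A $ 1 $ 2 / det A"
    "matrix_inv A $ 2 $ 1 = - A $ 2 $ 1 / det A" "matrix_inv A $ 2 $ 2 = A $ 1 $ 1 / det A"
    by (simp_all add: B_def d_def)
qed

lemma matrix_inv_2_scaleR:
  fixes A :: "real^2^2"
  assumes "det A \<noteq> 0" "c \<noteq> 0"
  shows "matrix_inv (c *\<^sub>R A) = (1 / c) *\<^sub>R matrix_inv A"
proof -
  have "det (c *\<^sub>R A) = c\<^sup>2 * det A" by (simp add: det_2 power2_eq_square algebra_simps)
  then show ?thesis
    using assms by (simp add: vec_eq_iff forall_2 matrix_inv_2 power2_eq_square)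
qed

lemma metric_inner_2:
  "metric_inner g x v w = g x $ 1 $ 1 * v $ 1 * w $ 1 + g x $ 1 $ 2 * v $ 1 * w $ 2
     + g x $ 2 $ 1 * v $ 2 * w $ 1 + g x $ 2 $ 2 * v $ 2 * w $ 2"
  by (simp add: metric_inner_def sum_2)

text \<open>Orthogonality expresses \<open>v $ 1\<close> through \<open>v $ 2\<close> and reduces
  the squared length to a positive multiple of \<open>(v $ 2)\<^sup>2\<close>. Unit length and the
  sign condition then leave exactly one vector, which resolves the definite description.\<close>

lemma outward_conormal_eq:
  assumes "g x $ 2 $ 1 = g x $ 1 $ 2" "g x $ 1 $ 1 > 0" "det (g x) > 0"
  defines "s \<equiv> sqrt (g x $ 1 $ 1 / det (g x))"
  shows "outward_conormal g x = vector [g x $ 1 $ 2 / g x $ 1 $ 1 * s, - s]"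
    and "metric_inner g x (outward_conormal g x) (outward_conormal g x) = 1"
    and "metric_inner g x (outward_conormal g x) (axis 1 1) = 0"
proof -
  let ?v = "vector [g x $ 1 $ 2 / g x $ 1 $ 1 * s, - s] :: real^2"
  let ?P = "\<lambda>v. metric_inner g x v v = 1 \<and> metric_inner g x v (axis 1 1) = 0 \<and> v $ 2 < 0"
  have det: "det (g x) = g x $ 1 $ 1 * g x $ 2 $ 2 - (g x $ 1 $ 2)\<^sup>2"
    using assms(1) by (simp add: det_2 power2_eq_square)
  have s: "s > 0" "s\<^sup>2 = g x $ 1 $ 1 / det (g x)"
    using assms by (simp_all add: s_def)
  have norm: "metric_inner g x v v = det (g x) / g x $ 1 $ 1 * (v $ 2)\<^sup>2"
    if "metric_inner g x v (axis 1 1) = 0" for v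
  proof -
    have "g x $ 1 $ 1 * v $ 1 = - g x $ 1 $ 2 * v $ 2"
      using that assms(1) by (simp add: metric_inner_2 axis_def)
    then have v1: "v $ 1 = - g x $ 1 $ 2 * v $ 2 / g x $ 1 $ 1"
      using assms(2) by (simp add: field_simps)
    show ?thesis
      using assms(1,2) unfolding metric_inner_2 det v1 by (simp add: field_simps power2_eq_square)
  qed
  have orth: "metric_inner g x ?v (axis 1 1) = 0"
    using assms(1,2) by (simp add: metric_inner_2 axis_def)
  have P: "?P ?v"
    using orth norm[OF orth] s assms(2,3) by simp
  have "v = ?v" if "?P v" for v
  proof -
    have "(v $ 2)\<^sup>2 = s\<^sup>2"
      using norm[of v] that s assms(2,3) by (simp add: field_simps)
    then have v2: "v $ 2 = - s" using power2_eq_iff[of "v $ 2" s] that s(1) by auto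
    have "g x $ 1 $ 1 * v $ 1 = g x $ 1 $ 2 * s"
      using that assms(1) v2 by (simp add: metric_inner_2 axis_def)
    then show ?thesis using v2 assms(2) by (simp add: vec_eq_iff forall_2 field_simps)
  qed
  then show e: "outward_conormal g x = ?v"
    unfolding outward_conormal_def using P by (intro the_equality) auto
  show "metric_inner g x (outward_conormal g x) (outward_conormal g x) = 1"
    "metric_inner g x (outward_conormal g x) (axis 1 1) = 0"
    using P by (simp_all add: e)
qed

text \<open>In the explicit formula the quotient of metric entries is unchanged, while the
  determinant scales by \<open>c\<^sup>2\<close>, so the square root scales by
  \<open>1 / sqrt c\<close>.\<close>

lemma outward_conormal_conformal:
  assumes "g' x = c *\<^sub>R g x" "c > 0"
    and "g x $ 2 $ 1 = g x $ 1 $ 2" "g x $ 1 $ 1 > 0" "det (g x) > 0"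
  shows "outward_conormal g' x = (1 / sqrt c) *\<^sub>R outward_conormal g x"
proof -
  have d: "det (c *\<^sub>R g x) = c\<^sup>2 * det (g x)"
    by (simp add: det_2 power2_eq_square algebra_simps)
  have "outward_conormal g' x = vector [g' x $ 1 $ 2 / g' x $ 1 $ 1 * sqrt (g' x $ 1 $ 1 / det (g' x)), - sqrt (g' x $ 1 $ 1 / det (g' x))]"
    using assms by (intro outward_conormal_eq(1)) (simp_all add: d)
  moreover have "sqrt (g' x $ 1 $ 1 / det (g' x)) = (1 / sqrt c) * sqrt (g x $ 1 $ 1 / det (g x))"
    using assms by (simp add: d power2_eq_square real_sqrt_divide real_sqrt_mult)
  ultimately show ?thesis
    using assms by (simp add: outward_conormal_eq(1) vec_eq_iff forall_2)
qed

section \<open>Orthogonality in three-space and the shape operator of a minimal surface\<close>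

text \<open>Expanding \<open>w \<times> (p \<times> q)\<close> shows that \<open>w\<close> has zero
  cross product with \<open>c = p \<times> q\<close>; expanding
  \<open>c \<times> (w \<times> c)\<close> then gives the identity.\<close>

lemma cross3_orthogonal:
  fixes p q w :: "real^3"
  assumes "p \<bullet> w = 0" "q \<bullet> w = 0"
  shows "(norm (cross3 p q))\<^sup>2 *\<^sub>R w = (cross3 p q \<bullet> w) *\<^sub>R cross3 p q"
proof -
  let ?c = "cross3 p q"
  have "cross3 w ?c = 0"
    using assms by (simp add: Lagrange inner_commute)
  then show ?thesis
    using Lagrange[of ?c w ?c] by (simp add: power2_norm_eq_inner)
qed

text \<open>The orthogonal complement of two independent vectors is the line spanned by their cross
  product, so \<open>w\<close> and \<open>z\<close> are parallel and Cauchy-Schwarz is an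
  equality.\<close>

lemma abs_inner_orthogonal:
  fixes p q w z :: "real^3"
  assumes "cross3 p q \<noteq> 0" "p \<bullet> w = 0" "q \<bullet> w = 0" "p \<bullet> z = 0" "q \<bullet> z = 0"
  shows "\<bar>w \<bullet> z\<bar> = norm w * norm z"
proof -
  let ?c = "cross3 p q"
  have parallel: "\<exists>a. u = a *\<^sub>R ?c" if "p \<bullet> u = 0" "q \<bullet> u = 0" for u
  proof -
    have "(1 / (norm ?c)\<^sup>2) *\<^sub>R ((norm ?c)\<^sup>2 *\<^sub>R u) = (1 / (norm ?c)\<^sup>2) *\<^sub>R ((?c \<bullet> u) *\<^sub>R ?c)"
      by (simp only: cross3_orthogonal[OF that])
    then have "u = ((?c \<bullet> u) / (norm ?c)\<^sup>2) *\<^sub>R ?c" using assms(1) by simp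
    then show ?thesis by blast
  qed
  obtain a b where "w = a *\<^sub>R ?c" "z = b *\<^sub>R ?c" using parallel assms(2-5) by blast
  then show ?thesis by (simp add: abs_mult dot_square_norm power2_eq_square)
qed

lemma orthogonal_frame_span:
  fixes y1 y2 n z :: "real^3"
  assumes "norm n = 1" "y1 \<bullet> n = 0" "y2 \<bullet> n = 0" "z \<bullet> n = 0"
    and "(y1 \<bullet> y1) * (y2 \<bullet> y2) - (y1 \<bullet> y2)\<^sup>2 \<noteq> 0"
  obtains a b where "z = a *\<^sub>R y1 + b *\<^sub>R y2"
proof -
  define d where "d = (y1 \<bullet> y1) * (y2 \<bullet> y2) - (y1 \<bullet> y2)\<^sup>2"
  \<comment> \<open>Cramer's rule for the Gram system of \<open>y1\<close>, \<open>y2\<close>, so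
    that the remainder \<open>w\<close> is orthogonal to both.\<close>
  define a where "a = ((z \<bullet> y1) * (y2 \<bullet> y2) - (z \<bullet> y2) * (y1 \<bullet> y2)) / d"
  define b where "b = ((z \<bullet> y2) * (y1 \<bullet> y1) - (z \<bullet> y1) * (y1 \<bullet> y2)) / d"
  define w where "w = z - (a *\<^sub>R y1 + b *\<^sub>R y2)"
  have d: "d \<noteq> 0" using assms(5) by (simp add: d_def)
  have "d * (y1 \<bullet> w) = 0" "d * (y2 \<bullet> w) = 0"
    using d by (simp_all add: w_def inner_diff inner_add a_def b_def inner_commute right_diff_distrib distrib_left)
      (simp_all add: d_def algebra_simps power2_eq_square inner_commute)
  then have y: "y1 \<bullet> w = 0" "y2 \<bullet> w = 0" using d by auto
  have n: "n \<bullet> w = 0" using assms by (simp add: w_def inner_diff inner_add inner_commute)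
  have "cross3 y1 y2 \<noteq> 0"
    using d norm_cross_dot[of y1 y2]
    by (auto simp: d_def power2_norm_eq_inner power_mult_distrib)
  \<comment> \<open>Both \<open>n\<close> and \<open>w\<close> are orthogonal to \<open>y1\<close>
    and \<open>y2\<close>, hence parallel; but \<open>n\<close> is also orthogonal to
    \<open>w\<close>.\<close>
  then have "\<bar>n \<bullet> w\<bar> = norm n * norm w"
    using assms y by (intro abs_inner_orthogonal[of y1 y2]) auto
  then have "w = 0" using n assms(1) by simp
  then show thesis by (intro that[of a b]) (simp add: w_def)
qed

text \<open>In the frame \<open>y1\<close>, \<open>y2\<close> the derivative of the normal has a 2
  by 2 matrix that is trace-free and symmetric for the metric \<open>E\<close>, \<open>F\<close>,
  \<open>G\<close>. By Cayley-Hamilton its square is \<open>a\<^sup>2 + b * c\<close> times the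
  identity, and \<open>\<phi>\<close> is half the trace of that square.\<close>

lemma shape_operator_square:
  fixes y1 y2 n n1 n2 :: "real^3"
  assumes "norm n = 1" "y1 \<bullet> n = 0" "y2 \<bullet> n = 0" "n1 \<bullet> n = 0" "n2 \<bullet> n = 0"
    and "n1 \<bullet> y2 = n2 \<bullet> y1"
    and EFG: "E = y1 \<bullet> y1" "F = y1 \<bullet> y2" "G = y2 \<bullet> y2"
    and d: "d = E * G - F\<^sup>2" "d \<noteq> 0"
    and h: "h11 = - (n1 \<bullet> y1)" "h12 = - (n1 \<bullet> y2)" "h22 = - (n2 \<bullet> y2)"
    and minimal: "G * h11 - 2 * F * h12 + E * h22 = 0"
    and \<phi>: "\<phi> = ((G * h11 - F * h12)\<^sup>2 + (E * h22 - F * h12)\<^sup>2 + 2 * (G * h12 - F * h22) * (E * h12 - F * h11)) / d\<^sup>2 / 2"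
  shows "n1 \<bullet> n1 = \<phi> * E" "n1 \<bullet> n2 = \<phi> * F" "n2 \<bullet> n2 = \<phi> * G"
proof -
  have d': "(y1 \<bullet> y1) * (y2 \<bullet> y2) - (y1 \<bullet> y2)\<^sup>2 \<noteq> 0" using d EFG by simp
  obtain a b where n1: "n1 = a *\<^sub>R y1 + b *\<^sub>R y2"
    using orthogonal_frame_span[OF assms(1-4) d'] by blast
  obtain c e where n2: "n2 = c *\<^sub>R y1 + e *\<^sub>R y2"
    using orthogonal_frame_span[OF assms(1-3,5) d'] by blast
  have h': "h11 = - (a * E + b * F)" "h12 = - (a * F + b * G)" "h22 = - (c * F + e * G)"
    and sym: "a * F + b * G = c * E + e * F"
    using h assms(6) by (simp_all add: n1 n2 EFG inner_add inner_commute)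
  \<comment> \<open>The mixed coefficient computed from \<open>n2\<close> instead of
    \<open>n1\<close>, needed for the second row of the matrix.\<close>
  have h21: "h12 = - (c * E + e * F)" using h' sym by simp
  have e1: "G * h11 - F * h12 = - a * d" "E * h12 - F * h11 = - b * d"
    unfolding h' d(1) by (simp_all add: algebra_simps power2_eq_square)
  have e2: "E * h22 - F * h12 = - e * d" "G * h12 - F * h22 = - c * d"
    unfolding h21 h'(3) d(1) by (simp_all add: algebra_simps power2_eq_square)
  have "(G * h11 - F * h12) + (E * h22 - F * h12) = 0" using minimal by simp
  \<comment> \<open>Minimality says that the matrix is trace-free.\<close>
  then have "(a + e) * d = 0" unfolding e1 e2 by (simp add: algebra_simps)
  then have e: "e = - a" using d(2) by simp
  have "\<phi> = (a\<^sup>2 * d\<^sup>2 + e\<^sup>2 * d\<^sup>2 + 2 * b * c * d\<^sup>2) / d\<^sup>2 / 2"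
    unfolding \<phi> e1 e2 by (simp add: power_mult_distrib power2_eq_square algebra_simps)
  also have "\<dots> = (a\<^sup>2 + e\<^sup>2 + 2 * b * c) / 2" using d(2) by (simp add: field_simps)
  finally have \<phi>': "\<phi> = a\<^sup>2 + b * c" by (simp add: e)
  \<comment> \<open>Symmetry for the metric, solved for \<open>b * G\<close>; together with the
    trace condition it suffices for all three identities.\<close>
  have bG: "b * G = c * E - 2 * a * F" using sym e by algebra
  have "n1 \<bullet> n1 = a\<^sup>2 * E + 2 * a * b * F + b * (b * G)"
    "n1 \<bullet> n2 = a * c * E - a\<^sup>2 * F + b * c * F - a * (b * G)"
    "n2 \<bullet> n2 = c * (c * E - 2 * a * F) + a\<^sup>2 * G"
    by (simp_all add: n1 n2 e EFG inner_add inner_commute power2_eq_square algebra_simps)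
  then show "n1 \<bullet> n1 = \<phi> * E" "n1 \<bullet> n2 = \<phi> * F" "n2 \<bullet> n2 = \<phi> * G"
    unfolding \<phi>' using bG by algebra+
qed

section \<open>Metrics in coordinates\<close>

lemma dh_eq_pd:
  assumes "linear (dh F x)"
  shows "dh F x v = v $ 1 *\<^sub>R pd 1 F x + v $ 2 *\<^sub>R pd 2 F x"
proof -
  have "v = v $ 1 *\<^sub>R axis 1 1 + v $ 2 *\<^sub>R axis 2 1"
    by (simp add: vec_eq_iff forall_2 axis_def)
  then have "dh F x v = dh F x (v $ 1 *\<^sub>R axis 1 1 + v $ 2 *\<^sub>R axis 2 1)" by simp
  then show ?thesis
    by (simp only: pd_def linear_add[OF assms] linear_scale[OF assms])
qed

lemma metric_inner_pullback:
  assumes "linear (dh F x)"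
  shows "metric_inner (pullback_metric F) x v w = dh F x v \<bullet> dh F x w"
  by (simp add: metric_inner_2 pullback_metric_def dh_eq_pd[OF assms, of v] dh_eq_pd[OF assms, of w]
      inner_add algebra_simps)

lemma pullback_metric_pos:
  assumes "linear (dh F x)" "inj (dh F x)"
  shows "pullback_metric F x $ 1 $ 1 > 0" "det (pullback_metric F x) > 0"
proof -
  let ?E = "pd 1 F x \<bullet> pd 1 F x" and ?F = "pd 1 F x \<bullet> pd 2 F x" and ?G = "pd 2 F x \<bullet> pd 2 F x"
  have nz: "dh F x v \<noteq> 0" if "v \<noteq> 0" for v
    using assms that linear_injective_0 by blast
  have E: "?E > 0" using nz[of "axis 1 1"] by (simp add: pd_def axis_eq_0_iff)
  then show "pullback_metric F x $ 1 $ 1 > 0" by (simp add: pullback_metric_def)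
  \<comment> \<open>Gram-Schmidt without division: the image of \<open>?v\<close> is orthogonal to
    \<open>pd 1 F x\<close>, and its squared length is \<open>?E\<close> times the
    determinant.\<close>
  let ?v = "?E *\<^sub>R axis 2 1 - ?F *\<^sub>R axis 1 1 :: real^2"
  have "?v $ 2 \<noteq> 0" using E by (simp add: axis_def)
  then have "?v \<noteq> 0" by (metis zero_index)
  then have "?E *\<^sub>R pd 2 F x - ?F *\<^sub>R pd 1 F x \<noteq> 0"
    using nz[OF \<open>?v \<noteq> 0\<close>] unfolding pd_def linear_diff[OF assms(1)] linear_scale[OF assms(1)] by blast
  then have "(?E *\<^sub>R pd 2 F x - ?F *\<^sub>R pd 1 F x) \<bullet> (?E *\<^sub>R pd 2 F x - ?F *\<^sub>R pd 1 F x) > 0" by simp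
  also have "(?E *\<^sub>R pd 2 F x - ?F *\<^sub>R pd 1 F x) \<bullet> (?E *\<^sub>R pd 2 F x - ?F *\<^sub>R pd 1 F x) = ?E * (?E * ?G - ?F\<^sup>2)"
    by (simp add: inner_diff inner_commute algebra_simps power2_eq_square)
  finally show "det (pullback_metric F x) > 0"
    using E by (simp add: zero_less_mult_iff det_2 pullback_metric_def power2_eq_square inner_commute)
qed

text \<open>In dimension two the area density scales by \<open>\<phi>\<close> and the inverse metric
  by \<open>1 / \<phi>\<close>, so the expression under the outer derivative is unchanged on all of
  \<open>D\<close>. Only the final division by the density contributes a factor.\<close>

lemma laplacian_conformal:
  assumes "openin (top_of_set half_plane) D" "x \<in> D"
    and "\<And>y. y \<in> D \<Longrightarrow> g' y = \<phi> y *\<^sub>R g y" "\<And>y. y \<in> D \<Longrightarrow> \<phi> y > 0" "\<And>y. y \<in> D \<Longrightarrow> det (g y) > 0"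
  shows "laplacian g' u x = laplacian g u x / \<phi> x"
proof -
  have d: "sqrt (det (g' y)) = \<phi> y * sqrt (det (g y))" if "y \<in> D" for y
  proof -
    have "det (g' y) = (\<phi> y)\<^sup>2 * det (g y)"
      using assms(3)[OF that] by (simp add: det_2 power2_eq_square algebra_simps)
    then show ?thesis using assms(4)[OF that] by (simp add: real_sqrt_mult)
  qed
  have "sqrt (det (g' y)) * (\<Sum>j\<in>UNIV. matrix_inv (g' y) $ i $ j * pd j u y)
      = sqrt (det (g y)) * (\<Sum>j\<in>UNIV. matrix_inv (g y) $ i $ j * pd j u y)" if "y \<in> D" for i y
  proof -
    have "matrix_inv (g' y) = (1 / \<phi> y) *\<^sub>R matrix_inv (g y)"
      using assms(3-5)[OF that] by (metis less_irrefl matrix_inv_2_scaleR)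
    then show ?thesis using d[OF that] assms(4)[OF that] by (simp add: sum_2 field_simps)
  qed
  then have "pd i (\<lambda>y. sqrt (det (g' y)) * (\<Sum>j\<in>UNIV. matrix_inv (g' y) $ i $ j * pd j u y)) x
      = pd i (\<lambda>y. sqrt (det (g y)) * (\<Sum>j\<in>UNIV. matrix_inv (g y) $ i $ j * pd j u y)) x" for i
    unfolding pd_def using dh_cong[OF assms(1,2)] by (metis (no_types, lifting))
  then show ?thesis
    using d[OF assms(2)] assms(2,4) by (simp add: laplacian_def)
qed

text \<open>The covariant acceleration of the induced metric is the tangential part of the Euclidean
  one, so both have the same product with a tangent vector. The minus sign comes from the inward
  conormal.\<close>

lemma boundary_geodesic_curvature_pullback:
  assumes D: "openin (top_of_set half_plane) D" and "smooth_on D N" and "x \<in> D" "x $ 2 = 0"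
    and "inj (dh N x)"
  shows "boundary_geodesic_curvature (pullback_metric N) x
    = - (pd 1 (pd 1 N) x \<bullet> dh N x (outward_conormal (pullback_metric N) x)) / (pd 1 N x \<bullet> pd 1 N x)"
proof -
  let ?g = "pullback_metric N" and ?\<gamma> = "\<lambda>t::real. vector [t, 0] :: real^2"
  let ?w = "- outward_conormal ?g x"
  have lin: "linear (dh N x)"
    using smooth_on_has_derivative[OF assms(1-3)] has_derivative_linear by blast
  note pos = pullback_metric_pos[OF lin assms(5)]
  have "(?\<gamma> has_vector_derivative axis 1 1) (at t)" for t
  proof -
    have "?\<gamma> = (\<lambda>t. t *\<^sub>R axis 1 1)"
      by (auto simp: fun_eq_iff vec_eq_iff forall_2 axis_def)
    then show ?thesis by (auto intro!: derivative_eq_intros)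
  qed
  then have v: "vector_derivative ?\<gamma> (at t) = axis 1 1" for t
    by (rule vector_derivative_at)
  have \<gamma>x: "?\<gamma> (x $ 1) = x" using assms(4) by (simp add: vec_eq_iff forall_2)
  have pdg: "pd k (\<lambda>y. ?g y $ i $ j) x = pd i N x \<bullet> pd k (pd j N) x + pd k (pd i N) x \<bullet> pd j N x" for i j k
    using dh_inner(1)[OF D smooth_on_pd[OF D assms(2)] smooth_on_pd[OF D assms(2)] assms(3)]
    by (simp add: pullback_metric_def pd_def[of k])
  \<comment> \<open>The terms pairing \<open>pd 1 N\<close> with a second derivative cancel because
    partial derivatives commute.\<close>
  have chr: "christoffel ?g k 1 1 x = (\<Sum>l\<in>UNIV. matrix_inv (?g x) $ k $ l * (pd 1 (pd 1 N) x \<bullet> pd l N x))" for k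
    unfolding christoffel_def pdg
    by (simp add: sum_2 pd_commute[OF D assms(2,3), of 1 2] inner_commute algebra_simps)
  have acc: "covariant_acceleration ?g ?\<gamma> (x $ 1) = (\<chi> k. christoffel ?g k 1 1 x)"
    by (simp add: covariant_acceleration_def Let_def v \<gamma>x vec_eq_iff sum_2 axis_def)
  define d where "d = det (?g x)"
  have sym: "?g x $ 2 $ 1 = ?g x $ 1 $ 2" by (simp add: pullback_metric_def inner_commute)
  have d: "d > 0" "?g x $ 1 $ 1 * ?g x $ 2 $ 2 = d + ?g x $ 1 $ 2 * ?g x $ 1 $ 2"
    using pos by (simp_all add: d_def det_2 sym)
  let ?c = "\<lambda>l. pd 1 (pd 1 N) x \<bullet> pd l N x"
  \<comment> \<open>The metric matrix times its explicit inverse, applied to \<open>(p, q)\<close>: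
    this cancels the inverse metric in the Christoffel symbols.\<close>
  have lower: "?g x $ 1 $ 1 * (?g x $ 2 $ 2 * p / d - ?g x $ 1 $ 2 * q / d)
      + ?g x $ 1 $ 2 * (?g x $ 1 $ 1 * q / d - ?g x $ 1 $ 2 * p / d) = p"
    "?g x $ 1 $ 2 * (?g x $ 2 $ 2 * p / d - ?g x $ 1 $ 2 * q / d)
      + ?g x $ 2 $ 2 * (?g x $ 1 $ 1 * q / d - ?g x $ 1 $ 2 * p / d) = q" for p q
  proof -
    have "?g x $ 1 $ 1 * (?g x $ 2 $ 2 * p / d - ?g x $ 1 $ 2 * q / d)
      + ?g x $ 1 $ 2 * (?g x $ 1 $ 1 * q / d - ?g x $ 1 $ 2 * p / d)
      = (?g x $ 1 $ 1 * ?g x $ 2 $ 2 - ?g x $ 1 $ 2 * ?g x $ 1 $ 2) * p / d"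
      "?g x $ 1 $ 2 * (?g x $ 2 $ 2 * p / d - ?g x $ 1 $ 2 * q / d)
      + ?g x $ 2 $ 2 * (?g x $ 1 $ 1 * q / d - ?g x $ 1 $ 2 * p / d)
      = (?g x $ 1 $ 1 * ?g x $ 2 $ 2 - ?g x $ 1 $ 2 * ?g x $ 1 $ 2) * q / d"
      by (simp_all add: algebra_simps diff_divide_distrib add_divide_distrib)
    then show "?g x $ 1 $ 1 * (?g x $ 2 $ 2 * p / d - ?g x $ 1 $ 2 * q / d)
      + ?g x $ 1 $ 2 * (?g x $ 1 $ 1 * q / d - ?g x $ 1 $ 2 * p / d) = p"
    "?g x $ 1 $ 2 * (?g x $ 2 $ 2 * p / d - ?g x $ 1 $ 2 * q / d)
      + ?g x $ 2 $ 2 * (?g x $ 1 $ 1 * q / d - ?g x $ 1 $ 2 * p / d) = q"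
      using d by simp_all
  qed
  have inv: "matrix_inv (?g x) $ 1 $ 1 = ?g x $ 2 $ 2 / d" "matrix_inv (?g x) $ 1 $ 2 = - ?g x $ 1 $ 2 / d"
    "matrix_inv (?g x) $ 2 $ 1 = - ?g x $ 1 $ 2 / d" "matrix_inv (?g x) $ 2 $ 2 = ?g x $ 1 $ 1 / d"
    using matrix_inv_2[of "?g x"] pos(2) by (simp_all add: d_def sym)
  \<comment> \<open>Lowering the index of the covariant acceleration leaves the tangential part of the
    Euclidean acceleration.\<close>
  have "metric_inner ?g x (covariant_acceleration ?g ?\<gamma> (x $ 1)) w = ?c 1 * w $ 1 + ?c 2 * w $ 2" for w
  proof -
    let ?a = "?g x $ 2 $ 2 * ?c 1 / d - ?g x $ 1 $ 2 * ?c 2 / d"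
      and ?b = "?g x $ 1 $ 1 * ?c 2 / d - ?g x $ 1 $ 2 * ?c 1 / d"
    have "metric_inner ?g x (covariant_acceleration ?g ?\<gamma> (x $ 1)) w
      = ?g x $ 1 $ 1 * ?a * w $ 1 + ?g x $ 1 $ 2 * ?a * w $ 2 + ?g x $ 1 $ 2 * ?b * w $ 1 + ?g x $ 2 $ 2 * ?b * w $ 2"
      unfolding metric_inner_2 acc by (simp add: chr sum_2 inv sym algebra_simps)
    also have "\<dots> = (?g x $ 1 $ 1 * ?a + ?g x $ 1 $ 2 * ?b) * w $ 1 + (?g x $ 1 $ 2 * ?a + ?g x $ 2 $ 2 * ?b) * w $ 2"
      by (simp only: distrib_right)
    finally show ?thesis unfolding lower .
  qed
  then have "metric_inner ?g x (covariant_acceleration ?g ?\<gamma> (x $ 1)) w = pd 1 (pd 1 N) x \<bullet> dh N x w" for w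
    by (simp add: dh_eq_pd[OF lin, of w] inner_add algebra_simps)
  moreover have "metric_inner ?g x (axis 1 1) (axis 1 1) = pd 1 N x \<bullet> pd 1 N x"
    by (simp add: metric_inner_pullback[OF lin] pd_def)
  ultimately show ?thesis
    by (simp add: boundary_geodesic_curvature_def Let_def v linear_neg[OF lin])
qed

section \<open>The Gauss map of a minimal surface\<close>

text \<open>A chart representative of the surface and of its Gauss map. The free boundary conditions
  are left out; they enter as premises of
  \<open>boundary_geodesic_curvature_gauss_metric\<close>.\<close>

locale minimal_chart =
  fixes D :: "(real^2) set" and Y N :: "real^2 \<Rightarrow> real^3"
  assumes openin_D: "openin (top_of_set half_plane) D"
    and smooth_Y: "smooth_on D Y" and smooth_N: "smooth_on D N"
    and inj_Y: "x \<in> D \<Longrightarrow> inj (dh Y x)" and inj_N: "x \<in> D \<Longrightarrow> inj (dh N x)"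
    and normal: "x \<in> D \<Longrightarrow> unit_normal Y x (N x)"
    and minimal: "x \<in> D \<Longrightarrow> mean_curvature Y x (N x) = 0"
begin

definition conformal_factor :: "real^2 \<Rightarrow> real" where
  "conformal_factor x = second_form_norm_sq Y x (N x) / 2"

lemma D_subset: "x \<in> D \<Longrightarrow> x \<in> half_plane"
  using openin_D openin_imp_subset by blast

lemma linear_dh: "x \<in> D \<Longrightarrow> linear (dh Y x)" "x \<in> D \<Longrightarrow> linear (dh N x)"
  using smooth_on_has_derivative[OF openin_D] smooth_Y smooth_N has_derivative_linear by blast+

text \<open>Differentiation of \<open>N y \<bullet> N y = 1\<close>, one-sided on the
  boundary.\<close>

lemma dh_N_orthogonal:
  assumes "x \<in> D" shows "dh N x v \<bullet> N x = 0"
proof -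
  have "dh (\<lambda>y. N y \<bullet> N y) x v = dh (\<lambda>y. 1) x v"
    using dh_cong[OF openin_D assms, of "\<lambda>y. N y \<bullet> N y" "\<lambda>y. 1"] normal
    by (simp add: unit_normal_def dot_square_norm)
  also have "\<dots> = 0" using dh_const D_subset[OF assms] by blast
  finally show ?thesis
    using dh_inner(1)[OF openin_D smooth_N smooth_N assms, of v] by (simp add: inner_commute)
qed

text \<open>The Weingarten equation, from differentiating
  \<open>pd j Y y \<bullet> N y = 0\<close>.\<close>

lemma second_form_eq:
  assumes "x \<in> D" shows "second_form Y x (N x) $ i $ j = - (pd i N x \<bullet> pd j Y x)"
proof -
  have "dh (\<lambda>y. pd j Y y \<bullet> N y) x v = dh (\<lambda>y. 0) x v" for v
    using dh_cong[OF openin_D assms, of "\<lambda>y. pd j Y y \<bullet> N y" "\<lambda>y. 0"] normal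
    by (simp add: unit_normal_def pd_def)
  also have "dh (\<lambda>y. 0::real) x v = 0" for v using dh_const D_subset[OF assms] by blast
  finally show ?thesis
    using dh_inner(1)[OF openin_D smooth_on_pd[OF openin_D smooth_Y] smooth_N assms, of j "axis i 1"]
    by (simp add: second_form_def pd_def[of i] inner_commute)
qed

lemma second_form_symmetric:
  assumes "x \<in> D" shows "second_form Y x (N x) $ i $ j = second_form Y x (N x) $ j $ i"
  using pd_commute[OF openin_D smooth_Y assms, of i j] by (simp add: second_form_def)

lemma gauss_metric_conformal:
  assumes "x \<in> D"
  shows "pullback_metric N x = conformal_factor x *\<^sub>R pullback_metric Y x"
proof -
  let ?g = "pullback_metric Y x" and ?h = "second_form Y x (N x)"
  define E F G where EFG: "E = pd 1 Y x \<bullet> pd 1 Y x" "F = pd 1 Y x \<bullet> pd 2 Y x" "G = pd 2 Y x \<bullet> pd 2 Y x"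
  define d where "d = E * G - F\<^sup>2"
  define h11 h12 h22 where h: "h11 = - (pd 1 N x \<bullet> pd 1 Y x)" "h12 = - (pd 1 N x \<bullet> pd 2 Y x)" "h22 = - (pd 2 N x \<bullet> pd 2 Y x)"
  have sym: "pd 1 N x \<bullet> pd 2 Y x = pd 2 N x \<bullet> pd 1 Y x"
    using second_form_symmetric[OF assms, of 1 2] by (simp add: second_form_eq[OF assms])
  have hh: "?h $ 1 $ 1 = h11" "?h $ 1 $ 2 = h12" "?h $ 2 $ 1 = h12" "?h $ 2 $ 2 = h22"
    using second_form_eq[OF assms] h sym by simp_all
  have det: "det ?g = d"
    by (simp add: d_def EFG det_2 pullback_metric_def inner_commute power2_eq_square)
  then have d: "d \<noteq> 0"
    using pullback_metric_pos[OF linear_dh(1)[OF assms] inj_Y[OF assms]] by simp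
  have inv: "matrix_inv ?g $ 1 $ 1 = G / d" "matrix_inv ?g $ 1 $ 2 = - F / d"
    "matrix_inv ?g $ 2 $ 1 = - F / d" "matrix_inv ?g $ 2 $ 2 = E / d"
    using matrix_inv_2[of ?g, unfolded det, OF d] by (simp_all add: pullback_metric_def EFG inner_commute)
  have "mean_curvature Y x (N x) = (G * h11 - 2 * F * h12 + E * h22) / d"
    by (simp add: mean_curvature_def sum_2 inv hh add_divide_distrib diff_divide_distrib)
  then have min: "G * h11 - 2 * F * h12 + E * h22 = 0" using minimal[OF assms] d by simp
  \<comment> \<open>The full contraction is regrouped as the trace of the square of the matrix
    obtained by raising one index of the second fundamental form.\<close>
  have "second_form_norm_sq Y x (N x) =
    ((G * h11 - F * h12)\<^sup>2 + (E * h22 - F * h12)\<^sup>2 + 2 * (G * h12 - F * h22) * (E * h12 - F * h11)) / d\<^sup>2"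
    using d by (simp add: second_form_norm_sq_def Let_def sum_2 inv hh power2_eq_square field_simps)
  then have \<phi>: "conformal_factor x = ((G * h11 - F * h12)\<^sup>2 + (E * h22 - F * h12)\<^sup>2 + 2 * (G * h12 - F * h22) * (E * h12 - F * h11)) / d\<^sup>2 / 2"
    by (simp add: conformal_factor_def)
  have n: "norm (N x) = 1" "pd i Y x \<bullet> N x = 0" "pd i N x \<bullet> N x = 0" for i
    using normal[OF assms] dh_N_orthogonal[OF assms] by (auto simp: unit_normal_def pd_def)
  note s = shape_operator_square[OF n(1) n(2) n(2) n(3) n(3) sym EFG d_def d h min \<phi>]
  show ?thesis
    using s by (simp add: vec_eq_iff forall_2 pullback_metric_def EFG inner_commute)
qed

lemma metric_pos:
  assumes "x \<in> D"
  shows "pullback_metric Y x $ 1 $ 1 > 0" "det (pullback_metric Y x) > 0"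
    "pullback_metric Y x $ 2 $ 1 = pullback_metric Y x $ 1 $ 2"
  using pullback_metric_pos[OF linear_dh(1)[OF assms] inj_Y[OF assms]]
  by (auto simp: pullback_metric_def inner_commute)

text \<open>Non-degeneracy enters here: the first diagonal entries of both metrics are positive, and
  the factor is their quotient.\<close>

lemma conformal_factor_pos:
  assumes "x \<in> D" shows "conformal_factor x > 0"
  using pullback_metric_pos(1)[OF linear_dh(2)[OF assms] inj_N[OF assms]] metric_pos(1)[OF assms]
  by (simp add: gauss_metric_conformal[OF assms] zero_less_mult_iff)

lemma laplacian_gauss_metric:
  assumes "x \<in> D"
  shows "laplacian (pullback_metric N) u x = laplacian (pullback_metric Y) u x / conformal_factor x"
  using laplacian_conformal[OF openin_D assms] gauss_metric_conformal conformal_factor_pos metric_pos(2)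
  by blast

lemma conormal_gauss_metric:
  assumes "x \<in> D"
  shows "outward_conormal (pullback_metric N) x
    = (1 / sqrt (conformal_factor x)) *\<^sub>R outward_conormal (pullback_metric Y) x"
  by (rule outward_conormal_conformal[OF gauss_metric_conformal conformal_factor_pos
        metric_pos(3,1,2)]) (rule assms)+

text \<open>Tangential differentiation of the boundary relations replaces the second derivative of
  \<open>N\<close> in the curvature by first derivatives; conformality then evaluates the
  quotient.\<close>

lemma boundary_geodesic_curvature_gauss_metric:
  assumes "x \<in> D" "x $ 2 = 0"
    and sphere: "\<And>y. y \<in> D \<Longrightarrow> y $ 2 = 0 \<Longrightarrow> norm (Y y) = 1"
    and orth: "\<And>y. y \<in> D \<Longrightarrow> y $ 2 = 0 \<Longrightarrow> N y \<bullet> Y y = 0"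
  shows "\<bar>boundary_geodesic_curvature (pullback_metric N) x\<bar> = 1 / sqrt (conformal_factor x)"
proof -
  \<comment> \<open>The free boundary condition makes the conormal \<open>?m\<close> of the Gauss image equal to \<open>\<plusminus>Y x\<close>.\<close>
  let ?m = "dh N x (outward_conormal (pullback_metric N) x)"
  \<comment> \<open>Product rule for a relation known only on the boundary, hence only in direction
    1.\<close>
  have product: "pd 1 f y \<bullet> g y = - (f y \<bullet> pd 1 g y)"
    if "smooth_on D f" "smooth_on D g" "y \<in> D" "y $ 2 = 0"
      "\<And>z. z \<in> D \<Longrightarrow> z $ 2 = 0 \<Longrightarrow> f z \<bullet> g z = c" for f g :: "real^2 \<Rightarrow> real^3" and c y
    using boundary_directional_derivative_zero[OF openin_D that(3,4)
        dh_inner(2)[OF openin_D that(1-3)] that(5)]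
    by (simp add: pd_def)
  have Y1: "pd 1 Y y \<bullet> Y y = 0" if "y \<in> D" "y $ 2 = 0" for y
    using product[OF smooth_Y smooth_Y that, of 1] sphere
    by (simp add: dot_square_norm inner_commute)
  have n: "N y \<bullet> N y = 1" "N y \<bullet> pd i Y y = 0" "N y \<bullet> pd i N y = 0" if "y \<in> D" for y i
    using normal[OF that] dh_N_orthogonal[OF that]
    by (auto simp: unit_normal_def pd_def inner_commute dot_square_norm)
  have N1: "pd 1 N y \<bullet> Y y = 0" if "y \<in> D" "y $ 2 = 0" for y
    using product[OF smooth_N smooth_Y that, of 0] orth n(2) that(1) by simp
  \<comment> \<open>The orthogonality relation \<open>N1\<close> holds along the whole boundary, so
    it can be differentiated again.\<close>
  have N11: "pd 1 (pd 1 N) x \<bullet> Y x = - (pd 1 N x \<bullet> pd 1 Y x)"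
    using product[OF smooth_on_pd[OF openin_D smooth_N] smooth_Y assms(1,2), of 1 0] N1 by simp
  have Yx: "norm (Y x) = 1" "N x \<bullet> Y x = 0" using sphere orth assms(1,2) by auto
  have lin: "linear (dh N x)" using linear_dh(2) assms(1) by blast
  note \<phi> = conformal_factor_pos[OF assms(1)]
  have g: "pullback_metric N x $ 2 $ 1 = pullback_metric N x $ 1 $ 2" "pullback_metric N x $ 1 $ 1 > 0"
    "det (pullback_metric N x) > 0"
    using pullback_metric_pos[OF lin inj_N[OF assms(1)]] by (auto simp: pullback_metric_def inner_commute)
  have m: "norm ?m = 1" "pd 1 N x \<bullet> ?m = 0"
    using outward_conormal_eq(2,3)[of "pullback_metric N" x, OF g]
    by (simp_all add: metric_inner_pullback[OF lin] pd_def inner_commute norm_eq_1)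
  have nz: "cross3 (N x) (pd 1 N x) \<noteq> 0" "cross3 (N x) (Y x) \<noteq> 0"
    using norm_cross_dot[of "N x" "pd 1 N x"] norm_cross_dot[of "N x" "Y x"] n(1,3)[OF assms(1)] Yx g(2)
    by (auto simp: pullback_metric_def norm_eq_1[symmetric])
  \<comment> \<open>Both unit vectors are orthogonal to \<open>N x\<close> and
    \<open>pd 1 N x\<close>.\<close>
  have "\<bar>?m \<bullet> Y x\<bar> = norm ?m * norm (Y x)"
    by (rule abs_inner_orthogonal[OF nz(1)])
      (use m Yx n[OF assms(1)] N1[OF assms(1,2)] dh_N_orthogonal[OF assms(1)] in \<open>simp_all add: inner_commute\<close>)
  then have "?m = Y x \<or> ?m = - Y x"
    using norm_cauchy_schwarz_abs_eq[of ?m "Y x"] m(1) Yx(1) by auto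
  then have "\<bar>pd 1 (pd 1 N) x \<bullet> ?m\<bar> = \<bar>pd 1 N x \<bullet> pd 1 Y x\<bar>"
    using N11 by auto
  \<comment> \<open>Both derivatives are orthogonal to \<open>N x\<close> and \<open>Y x\<close>,
    hence parallel: the boundary direction is principal.\<close>
  also have "\<dots> = norm (pd 1 N x) * norm (pd 1 Y x)"
    by (rule abs_inner_orthogonal[OF nz(2)])
      (use n[OF assms(1)] N1[OF assms(1,2)] Y1[OF assms(1,2)] in \<open>simp_all add: inner_commute\<close>)
  finally have "\<bar>boundary_geodesic_curvature (pullback_metric N) x\<bar> = norm (pd 1 N x) * norm (pd 1 Y x) / (norm (pd 1 N x))\<^sup>2"
    by (simp add: boundary_geodesic_curvature_pullback[OF openin_D smooth_N assms(1,2) inj_N[OF assms(1)]]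
        power2_norm_eq_inner)
  moreover have "(norm (pd 1 N x))\<^sup>2 = conformal_factor x * (norm (pd 1 Y x))\<^sup>2"
    using arg_cong[OF gauss_metric_conformal[OF assms(1)], of "\<lambda>g. g $ 1 $ 1"]
    by (simp add: pullback_metric_def power2_norm_eq_inner)
  then have "norm (pd 1 N x) = sqrt (conformal_factor x) * norm (pd 1 Y x)"
    by (metis norm_ge_zero real_sqrt_mult real_sqrt_unique real_sqrt_pow2)
  moreover have "norm (pd 1 Y x) \<noteq> 0"
    using metric_pos(1)[OF assms(1)] by (auto simp: pullback_metric_def)
  ultimately show ?thesis using \<phi> by (simp add: power2_eq_square)
qed

end

section \<open>From charts to the eigenvalue problems on the surface\<close>

lemma minimal_chart_of_free_boundary:
  assumes "free_boundary_minimal_surface M A X" "gauss_map A X \<nu>" "immersion A \<nu>" "(D, \<psi>) \<in> A"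
  shows "minimal_chart D (X \<circ> \<psi>) (\<nu> \<circ> \<psi>)"
proof
  show "openin (top_of_set half_plane) D"
    using assms(1,4) by (fastforce simp: free_boundary_minimal_surface_def smooth_surface_def local_parametrization_def)
  show "mean_curvature (X \<circ> \<psi>) x ((\<nu> \<circ> \<psi>) x) = 0" if "x \<in> D" for x
    using assms(1,2,4) that by (fastforce simp: free_boundary_minimal_surface_def gauss_map_def)
qed (use assms in \<open>auto simp: free_boundary_minimal_surface_def immersion_def smooth_function_def gauss_map_def\<close>)

theorem theorem2p9:
  fixes M :: "'a topology" and A :: "'a chart set"
    and X \<nu> :: "'a \<Rightarrow> real^3" and \<mu> :: real
  assumes "free_boundary_minimal_surface M A X"
    and "gauss_map A X \<nu>"
    and "immersion A \<nu>"
  shows "jacobi_steklov_eigenvalue M A X \<nu> \<mu> \<longleftrightarrow> gauss_image_eigenvalue M A \<nu> \<mu>"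
proof -
  \<comment> \<open>The two equations differ by the positive factor
    \<open>conformal_factor x\<close>, for one and the same \<open>u\<close>.\<close>
  have interior: "laplacian (pullback_metric (X \<circ> \<psi>)) (u \<circ> \<psi>) x
        + second_form_norm_sq (X \<circ> \<psi>) x (\<nu> (\<psi> x)) * u (\<psi> x) = 0
      \<longleftrightarrow> laplacian (pullback_metric (\<nu> \<circ> \<psi>)) (u \<circ> \<psi>) x + 2 * u (\<psi> x) = 0"
    if "(D, \<psi>) \<in> A" "x \<in> D" for D \<psi> x and u :: "'a \<Rightarrow> real"
  proof -
    interpret minimal_chart D "X \<circ> \<psi>" "\<nu> \<circ> \<psi>"
      using minimal_chart_of_free_boundary[OF assms that(1)] .
    have "second_form_norm_sq (X \<circ> \<psi>) x (\<nu> (\<psi> x)) = 2 * conformal_factor x"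
      by (simp add: conformal_factor_def)
    then show ?thesis
      using conformal_factor_pos[OF that(2)] by (simp add: laplacian_gauss_metric[OF that(2)] field_simps)
  qed
  have boundary: "dh (u \<circ> \<psi>) x (outward_conormal (pullback_metric (X \<circ> \<psi>)) x) = \<mu> * u (\<psi> x)
      \<longleftrightarrow> dh (u \<circ> \<psi>) x (outward_conormal (pullback_metric (\<nu> \<circ> \<psi>)) x)
        = \<bar>boundary_geodesic_curvature (pullback_metric (\<nu> \<circ> \<psi>)) x\<bar> * \<mu> * u (\<psi> x)"
    if "smooth_function A u" "(D, \<psi>) \<in> A" "x \<in> D" "x $ 2 = 0" for D \<psi> x and u :: "'a \<Rightarrow> real"
  proof -
    interpret minimal_chart D "X \<circ> \<psi>" "\<nu> \<circ> \<psi>"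
      using minimal_chart_of_free_boundary[OF assms that(2)] .
    have "smooth_on D (u \<circ> \<psi>)" using that(1,2) by (auto simp: smooth_function_def)
    \<comment> \<open>Linearity lets the scaling factor of the conormal be pulled out of the
      derivative of \<open>u\<close>.\<close>
    then have lin: "linear (dh (u \<circ> \<psi>) x)"
      using smooth_on_has_derivative[OF openin_D] that(3) has_derivative_linear by blast
    have "norm ((X \<circ> \<psi>) y) = 1" if "y \<in> D" "y $ 2 = 0" for y
    proof -
      have "\<psi> y \<in> surface_boundary A"
        using \<open>(D, \<psi>) \<in> A\<close> that by (auto simp: surface_boundary_def)
      then have "X (\<psi> y) \<in> sphere 0 1"
        using assms(1) unfolding free_boundary_minimal_surface_def by blast
      then show ?thesis by simp
    qed
    moreover have "(\<nu> \<circ> \<psi>) y \<bullet> (X \<circ> \<psi>) y = 0" if "y \<in> D" "y $ 2 = 0" for y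
      using assms(1) \<open>(D, \<psi>) \<in> A\<close> that normal[OF that(1)]
      by (fastforce simp: free_boundary_minimal_surface_def)
    ultimately have "\<bar>boundary_geodesic_curvature (pullback_metric (\<nu> \<circ> \<psi>)) x\<bar> = 1 / sqrt (conformal_factor x)"
      using that(3,4) by (intro boundary_geodesic_curvature_gauss_metric)
    then show ?thesis
      using conformal_factor_pos[OF that(3)]
      by (simp add: conormal_gauss_metric[OF that(3)] linear_scale[OF lin] field_simps)
  qed
  show ?thesis
    unfolding jacobi_steklov_eigenvalue_def gauss_image_eigenvalue_def Let_def
    \<comment> \<open>The same \<open>u\<close> is a witness on both sides; \<open>conj_cong\<close>
      makes its smoothness available to \<open>boundary\<close>.\<close>
    by (intro ex_cong1 conj_cong refl ball_cong) (auto simp: interior boundary)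
qed

end
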